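(* Let $m\ge 1$, let $\rho(\mathbf{x})=2^{-m}$ on $[-1,1]^m$ (and $0$ elsewhere), and let $f:[-1,1]^m\to\mathbb{R}$ be differentiable and square-integrable with square-integrable partial derivatives. Let $\mathbf{C}=\int \nabla f(\mathbf{x})\,\nabla f(\mathbf{x})^T\,\rho(\mathbf{x})\,d\mathbf{x}=\mathbf{W}\Lambda\mathbf{W}^T$ be an eigendecomposition with $\mathbf{W}=(w_{i,j})$ orthogonal and $\Lambda=\operatorname{diag}(\lambda_1,\dots,\lambda_m)$, $\lambda_1\ge\dots\ge\lambda_m$. For $1\le n\le m$ and $1\le i\le m$ let $$\alpha_i(n)=\sum_{j=1}^n\lambda_j\,w_{i,j}^2,\qquad \nu_i=\int\left(\frac{\partial f}{\partial x_i}(\mathbf{x})\right)^2\rho(\mathbf{x})\,d\mathbf{x}.$$ Then for every $n\in\{1,\dots,m\}$, $$\alpha_i(n)\le \nu_i,\qquad i=1,\dots,m,$$ and the inequality becomes an equality when $n=m$, i.e. $\alpha_i(m)=\nu_i$ for all $i=1,\dots,m$.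
   Context: The number $\alpha_i(n)$ is called the activity score of the $i$th input variable, and $\nu_i$ is called the derivative-based global sensitivity measure of the $i$th input variable. The matrix $\mathbf{C}$ is an $m\times m$ symmetric positive semidefinite matrix whose entries are $\mathbf{C}_{kl}=\int \frac{\partial f}{\partial x_k}\frac{\partial f}{\partial x_l}\,\rho\,d\mathbf{x}$. The $j$th column of $\mathbf{W}$ is the eigenvector associated with $\lambda_j$, and $w_{i,j}$ is the $(i,j)$ entry of $\mathbf{W}$. *)

theory Defs
  imports "HOL-Analysis.Analysis"
begin

definition cube :: "(real ^ 'm) set" where
  "cube = cbox (\<chi> i. - 1) (\<chi> i. 1)"

definition unif_dens :: "real ^ 'm \<Rightarrow> real" where
  "unif_dens x = (if x \<in> cube then 1 / 2 ^ CARD('m) else 0)"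

definition square_integrable :: "(real ^ 'm \<Rightarrow> real) \<Rightarrow> bool" where
  "square_integrable g \<longleftrightarrow>
     set_borel_measurable lborel cube g \<and> integrable lborel (\<lambda>x. (g x)\<^sup>2 * unif_dens x)"

text \<open>The derivative is taken within the cube: functions are only meaningful there, and on the
  faces where \<open>x $ i = 1\<close> or \<open>x $ i = -1\<close> the partial derivative is one-sided.\<close>

definition partial_deriv :: "'m \<Rightarrow> (real ^ 'm \<Rightarrow> real) \<Rightarrow> real ^ 'm \<Rightarrow> real" where
  "partial_deriv i f x =
     vector_derivative (\<lambda>t. f (x + t *\<^sub>R axis i 1)) (at 0 within {t. x + t *\<^sub>R axis i 1 \<in> cube})"

definition grad_outer_matrix :: "(real ^ 'm \<Rightarrow> real) \<Rightarrow> real ^ 'm ^ 'm" where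
  "grad_outer_matrix f =
     (\<chi> k l. \<integral>x. partial_deriv k f x * partial_deriv l f x * unif_dens x \<partial>lborel)"

definition diag_matrix :: "('m \<Rightarrow> real) \<Rightarrow> real ^ 'm ^ 'm" where
  "diag_matrix d = (\<chi> i j. if i = j then d i else 0)"

text \<open>The index type \<open>'m\<close> carries no order, so "the first \<open>n\<close> eigenpairs" refer to a numbering
  \<open>e\<close> of \<open>'m\<close> by \<open>{1..CARD('m)}\<close>: the \<open>j\<close>-th eigenvalue is \<open>lam (e j)\<close>, and its eigenvector
  is column \<open>e j\<close> of \<open>W\<close>.\<close>

definition activity_score ::
  "(nat \<Rightarrow> 'm) \<Rightarrow> ('m \<Rightarrow> real) \<Rightarrow> real ^ 'm ^ 'm \<Rightarrow> 'm \<Rightarrow> nat \<Rightarrow> real" where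
  "activity_score e lam W i n = (\<Sum>j = 1..n. lam (e j) * (W $ i $ e j)\<^sup>2)"

definition dgsm :: "(real ^ 'm \<Rightarrow> real) \<Rightarrow> 'm \<Rightarrow> real" where
  "dgsm f i = (\<integral>x. (partial_deriv i f x)\<^sup>2 * unif_dens x \<partial>lborel)"

end

theory Submission
  imports Defs
begin

text \<open>Entrywise, \<open>\<nu>\<^sub>i = C\<^sub>i\<^sub>i = (\<Sum>j. \<lambda>\<^sub>j w\<^sub>i\<^sub>j\<^sup>2)\<close>, which is the case \<open>n = m\<close>. Each
  \<open>\<lambda>\<^sub>j = w\<^sub>j\<^sup>T C w\<^sub>j = \<integral>(w\<^sub>j \<bullet> \<nabla>f)\<^sup>2 \<rho>\<close> is nonnegative, so truncating the sum can only decrease it.\<close>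

lemma unif_dens_nonneg: "unif_dens x \<ge> 0"
  by (simp add: unif_dens_def)

text \<open>The product is dominated by the sum of the two squares, whose integrability against the
  density is assumed. This makes every entry of \<open>grad_outer_matrix\<close> a genuine
  integral.\<close>

lemma integrable_mult_square_integrable:
  fixes g h :: "real ^ 'm \<Rightarrow> real"
  assumes "square_integrable g" "square_integrable h"
  shows "integrable lborel (\<lambda>x. g x * h x * unif_dens x)"
proof (rule Bochner_Integration.integrable_bound)
  show "integrable lborel (\<lambda>x. (g x)\<^sup>2 * unif_dens x + (h x)\<^sup>2 * unif_dens x)"
    using assms by (simp add: square_integrable_def)
  \<comment> \<open>Measurability of \<open>g\<close> and \<open>h\<close> is known only on the
    cube. Since the density vanishes elsewhere, the integrand can be written with the restricted
    functions alone.\<close>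
  have "(\<lambda>x. (indicator cube x *\<^sub>R g x) * (indicator cube x *\<^sub>R h x) / 2 ^ CARD('m))
      \<in> borel_measurable lborel"
    using assms unfolding square_integrable_def set_borel_measurable_def
    by (intro borel_measurable_divide borel_measurable_times) auto
  moreover have "(\<lambda>x. (indicator cube x *\<^sub>R g x) * (indicator cube x *\<^sub>R h x) / 2 ^ CARD('m))
      = (\<lambda>x. g x * h x * unif_dens x)"
    by (auto simp: unif_dens_def indicator_def)
  ultimately show "(\<lambda>x. g x * h x * unif_dens x) \<in> borel_measurable lborel"
    by simp
  \<comment> \<open>The inequality 2ab \<le> a^2 + b^2 at the absolute values is stronger than
    needed; the factor 2 is dropped because ab \<ge> 0.\<close>
  have "\<bar>g x * h x\<bar> \<le> (g x)\<^sup>2 + (h x)\<^sup>2" for x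
    using sum_squares_bound[of "\<bar>g x\<bar>" "\<bar>h x\<bar>"] abs_ge_zero[of "g x * h x"]
    unfolding abs_mult power2_abs by linarith
  then have "\<bar>g x * h x\<bar> * unif_dens x \<le> ((g x)\<^sup>2 + (h x)\<^sup>2) * unif_dens x" for x
    by (intro mult_right_mono unif_dens_nonneg)
  then show "AE x in lborel. norm (g x * h x * unif_dens x)
      \<le> norm ((g x)\<^sup>2 * unif_dens x + (h x)\<^sup>2 * unif_dens x)"
    by (simp add: abs_mult unif_dens_nonneg algebra_simps)
qed

lemma grad_outer_matrix_quadratic_form_nonneg:
  fixes f :: "real ^ 'm \<Rightarrow> real"
  assumes "\<And>i. square_integrable (partial_deriv i f)"
  shows "v \<bullet> (grad_outer_matrix f *v v) \<ge> 0"
proof -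
  \<comment> \<open>Exchanging the finite sums with the integral requires each summand to be
    integrable: a non-integrable function has Bochner integral 0 by default, so additivity could
    fail.\<close>
  have int: "integrable lborel
      (\<lambda>x. v $ k * v $ l * (partial_deriv k f x * partial_deriv l f x * unif_dens x))" for k l
    by (intro integrable_mult_right integrable_mult_square_integrable assms)
  have "v \<bullet> (grad_outer_matrix f *v v) = (\<Sum>k\<in>UNIV. \<Sum>l\<in>UNIV.
      (\<integral>x. v $ k * v $ l * (partial_deriv k f x * partial_deriv l f x * unif_dens x) \<partial>lborel))"
    by (simp add: inner_vec_def matrix_vector_mult_def grad_outer_matrix_def sum_distrib_left)
      (simp add: ac_simps)
  also have "\<dots> = (\<integral>x. (\<Sum>k\<in>UNIV. \<Sum>l\<in>UNIV.
      v $ k * v $ l * (partial_deriv k f x * partial_deriv l f x * unif_dens x)) \<partial>lborel)"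
    using int by (simp add: Bochner_Integration.integral_sum Bochner_Integration.integrable_sum)
  \<comment> \<open>The double sum is the expanded square of v \<bullet> \<nabla>f.\<close>
  also have "\<dots> = (\<integral>x. (\<Sum>k\<in>UNIV. v $ k * partial_deriv k f x)\<^sup>2 * unif_dens x \<partial>lborel)"
    unfolding power2_eq_square sum_product unfolding sum_distrib_right by (simp only: ac_simps)
  also have "\<dots> \<ge> 0"
    by (intro integral_nonneg_AE AE_I2 mult_nonneg_nonneg zero_le_power2 unif_dens_nonneg)
  finally show ?thesis .
qed

text \<open>The diagonal factor collapses one of the two summations of the triple product. At
  \<open>k = i\<close> the remaining sum is the activity score over all columns.\<close>

lemma diag_conjugate_nth:
  "(W ** diag_matrix lam ** transpose W) $ i $ k = (\<Sum>j\<in>UNIV. lam j * W $ i $ j * W $ k $ j)"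
  by (simp add: matrix_matrix_mult_def diag_matrix_def transpose_def if_distrib[of "\<lambda>y. _ * y"] ac_simps
      cong: if_cong)

text \<open>Column \<open>j\<close> is a unit eigenvector for \<open>lam j\<close>, so its Rayleigh
  quotient recovers the eigenvalue. This turns nonnegativity of the quadratic form into
  nonnegativity of \<open>lam\<close>.\<close>

lemma diag_conjugate_eigenvalue:
  fixes W :: "real ^ 'm ^ 'm"
  assumes "orthogonal_matrix W"
  shows "column j W \<bullet> ((W ** diag_matrix lam ** transpose W) *v column j W) = lam j"
proof -
  have W: "transpose W ** W = mat 1"
    using assms by (simp add: orthogonal_matrix_def)
  \<comment> \<open>In this form the column brings its own factor \<open>W\<close>, which cancels
    against a \<open>transpose W\<close> on either side of the inner product.\<close>
  have col: "column j W = W *v axis j 1"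
    by (simp add: matrix_vector_mult_basis)
  have "(W ** diag_matrix lam ** transpose W) *v column j W
      = W *v (diag_matrix lam *v ((transpose W ** W) *v axis j 1))"
    unfolding col by (simp only: matrix_vector_mul_assoc matrix_mul_assoc)
  \<comment> \<open>The leftmost \<open>W\<close> crosses the inner product as its
    transpose.\<close>
  then have "column j W \<bullet> ((W ** diag_matrix lam ** transpose W) *v column j W)
      = (transpose W *v (W *v axis j 1)) \<bullet> (diag_matrix lam *v axis j 1)"
    unfolding col by (simp only: W matrix_vector_mul_lid dot_lmul_matrix[symmetric] vector_transpose_matrix
        transpose_matrix_vector)
  also have "\<dots> = axis j 1 \<bullet> (diag_matrix lam *v axis j 1)"
    by (simp only: W matrix_vector_mul_lid matrix_vector_mul_assoc)
  also have "\<dots> = lam j"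
    by (simp add: inner_axis' matrix_vector_mult_basis column_def diag_matrix_def)
  finally show ?thesis .
qed

theorem theorem4p1:
  fixes f :: "real ^ 'm \<Rightarrow> real"
    and W :: "real ^ 'm ^ 'm"
    and lam :: "'m \<Rightarrow> real"
    and e :: "nat \<Rightarrow> 'm"
  assumes "bij_betw e {1..CARD('m)} UNIV"
    and "f differentiable_on cube"
    and "square_integrable f"
    and "\<And>i. square_integrable (partial_deriv i f)"
    and "orthogonal_matrix W"
    and "grad_outer_matrix f = W ** diag_matrix lam ** transpose W"
    and "\<And>j k. 1 \<le> j \<Longrightarrow> j \<le> k \<Longrightarrow> k \<le> CARD('m) \<Longrightarrow> lam (e k) \<le> lam (e j)"
  shows "(\<forall>n\<in>{1..CARD('m)}. \<forall>i. activity_score e lam W i n \<le> dgsm f i) \<and>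
         (\<forall>i. activity_score e lam W i CARD('m) = dgsm f i)"
proof -
  have nonneg: "lam j \<ge> 0" for j
    using grad_outer_matrix_quadratic_form_nonneg[OF assms(4), of "column j W"]
    by (simp only: assms(6) diag_conjugate_eigenvalue[OF assms(5)])
  have full: "activity_score e lam W i CARD('m) = dgsm f i" for i
  proof -
    \<comment> \<open>At full length the numbering \<open>e\<close> meets each index exactly once,
      so it can be summed away.\<close>
    have "activity_score e lam W i CARD('m) = (\<Sum>j\<in>UNIV. lam j * (W $ i $ j)\<^sup>2)"
      unfolding activity_score_def by (rule sum.reindex_bij_betw[OF assms(1)])
    also have "\<dots> = grad_outer_matrix f $ i $ i"
      by (simp add: assms(6) diag_conjugate_nth power2_eq_square ac_simps)
    also have "\<dots> = dgsm f i"
      by (simp add: grad_outer_matrix_def dgsm_def power2_eq_square)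
    finally show ?thesis .
  qed
  \<comment> \<open>The bound is first taken against the full score, which \<open>full\<close>
    identifies with \<open>dgsm f i\<close>.\<close>
  have "activity_score e lam W i n \<le> activity_score e lam W i CARD('m)"
    if "n \<le> CARD('m)" for n i
    unfolding activity_score_def using that
    by (intro sum_mono2) (auto simp: nonneg)
  then show ?thesis
    by (simp add: full)
qed

end
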